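(* Let $n\ge1$ and let $A,B$ be convex bodies in $\mathbb{R}^n$ such that for every $1\le k\le n$, every $k$-dimensional linear subspace $E$ of $\mathbb{R}^n$ and every unit vector $u\in E$, $$\frac{|P_E(A+B)|_k}{|P_{E\cap u^\perp}(A+B)|_{k-1}}\ge\frac{|P_EA|_k}{|P_{E\cap u^\perp}A|_{k-1}}.$$ Then for every zonoid $Z$ in $\mathbb{R}^n$, $$|A|\,|A+B+Z|\le|A+B|\,|A+Z|.$$
   Context: $P_F$ denotes orthogonal projection onto a linear subspace $F$, $u^\perp$ is the hyperplane orthogonal to $u$, $|\cdot|_k$ is $k$-dimensional volume (with $|\cdot|_0$ of a point equal to $1$), and $|\cdot|=|\cdot|_n$. $+$ is Minkowski addition; a convex body is a compact convex set with nonempty interior. A zonotope is a Minkowski sum of finitely many line segments; a zonoid is a limit of zonotopes in the Hausdorff metric. *)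

theory Defs
  imports "HOL-Analysis.Analysis"
begin

definition convex_body :: "'a::euclidean_space set \<Rightarrow> bool" where
  "convex_body K \<longleftrightarrow> compact K \<and> convex K \<and> interior K \<noteq> {}"

definition proj :: "'a::euclidean_space set \<Rightarrow> 'a \<Rightarrow> 'a" where
  "proj F x = (THE y. y \<in> F \<and> (\<forall>e\<in>F. (x - y) \<bullet> e = 0))"

definition orth_hyp :: "'a::euclidean_space \<Rightarrow> 'a set" where
  "orth_hyp u = {x. x \<bullet> u = 0}"

definition onb :: "'a::euclidean_space set \<Rightarrow> 'a list" where
  "onb F = (SOME bs. distinct bs \<and> set bs \<subseteq> F \<and> span (set bs) = F \<and>
      (\<forall>i<length bs. \<forall>j<length bs. bs ! i \<bullet> bs ! j = (if i = j then 1 else 0)))"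

text \<open>(dim F)-dimensional volume of a set S contained in the linear subspace F:
  Lebesgue measure on R^k (k = dim F) of the coordinates of S w.r.t. an orthonormal
  basis of F. For k = 0 a point has volume 1.\<close>
definition kvol :: "'a::euclidean_space set \<Rightarrow> 'a set \<Rightarrow> real" where
  "kvol F S = (let bs = onb F; k = length bs in
     measure (PiM {..<k} (\<lambda>_. lborel))
       {c \<in> space (PiM {..<k} (\<lambda>_. lborel)). (\<Sum>i<k. c i *\<^sub>R bs ! i) \<in> S})"

definition zonotope :: "'a::euclidean_space set \<Rightarrow> bool" where
  "zonotope Z \<longleftrightarrow> (\<exists>segs :: ('a \<times> 'a) list.
      Z = foldr (\<lambda>(a, b) S. closed_segment a b + S) segs {0})"

definition hausdorff_dist :: "'a::euclidean_space set \<Rightarrow> 'a set \<Rightarrow> real" where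
  "hausdorff_dist A B = max (SUP a\<in>A. infdist a B) (SUP b\<in>B. infdist b A)"

definition zonoid :: "'a::euclidean_space set \<Rightarrow> bool" where
  "zonoid Z \<longleftrightarrow> compact Z \<and> Z \<noteq> {} \<and>
     (\<exists>Zs. (\<forall>m. zonotope (Zs m)) \<and> (\<lambda>m. hausdorff_dist (Zs m) Z) \<longlonglongrightarrow> 0)"

end

theory Submission
  imports Defs
begin

text \<open>Write \<open>C = A + B\<close>. By induction on the number of segments of a zonotope \<open>Z\<close> one shows
  \<open>|P_E A| |P_E (C + Z)| \<le> |P_E C| |P_E (A + Z)|\<close> simultaneously for all subspaces \<open>E\<close>. Adding a
  segment to \<open>K\<close> whose projection to \<open>E\<close> has length \<open>t\<close> and direction \<open>u\<close> increases \<open>|P_E K|\<close> by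
  \<open>t |P_F K|\<close>, where \<open>F\<close> is the orthogonal complement of \<open>u\<close> in \<open>E\<close>; the induction hypotheses for \<open>E\<close>
  and \<open>F\<close> combine by the assumption on \<open>E\<close> and \<open>u\<close>. The case \<open>E = UNIV\<close> passes to zonoids by
  semicontinuity of the volume.\<close>

subsection \<open>Lebesgue measure on a subspace\<close>

text \<open>\<open>kvol\<close> is computed in one unspecified orthonormal basis of each subspace,
  whereas the segment formula needs a basis of \<open>E\<close> that extends one of \<open>F\<close>
  by \<open>u\<close>. The obstacle is therefore independence of the basis. It is derived from
  uniqueness of Haar measure; to make that argument available, volume on a subspace is treated as a
  Borel measure on the whole ambient space, concentrated on the subspace.

  In the limit the two sides call for different estimates. For a zonotope \<open>W\<close> near
  \<open>Z\<close>, the volume of \<open>C + Z\<close> has to be bounded, up to a small error, by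
  that of \<open>C + W\<close>; this is a dilation argument, based on a ball in \<open>C\<close> and
  on convexity of \<open>C\<close> and \<open>W\<close>. The volume of \<open>A + W\<close> has to
  be bounded by that of \<open>A + Z\<close>; this is outer regularity at a compact set.\<close>

interpretation lborel_family: product_sigma_finite "\<lambda>_ :: nat. lborel :: real measure"
  by standard

definition orthonormal_list :: "'a::euclidean_space list \<Rightarrow> bool" where
  "orthonormal_list bs \<longleftrightarrow>
     (\<forall>i<length bs. \<forall>j<length bs. bs ! i \<bullet> bs ! j = (if i = j then 1 else 0))"

definition lin_comb :: "'a::euclidean_space list \<Rightarrow> (nat \<Rightarrow> real) \<Rightarrow> 'a" where
  "lin_comb bs c = (\<Sum>i<length bs. c i *\<^sub>R bs ! i)"

text \<open>A measure on the ambient space, not on coordinates: measures that come from different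
  bases of one subspace can then be compared, and translations and Fubini apply without changing
  spaces.\<close>

definition coord_measure :: "'a::euclidean_space list \<Rightarrow> 'a measure" where
  "coord_measure bs = distr (PiM {..<length bs} (\<lambda>_. lborel)) borel (lin_comb bs)"

lemma lin_comb_in_span: "lin_comb bs c \<in> span (set bs)"
  unfolding lin_comb_def by (intro span_sum span_scale span_base) auto

lemma lin_comb_inner:
  assumes "orthonormal_list bs" "j < length bs"
  shows "lin_comb bs c \<bullet> bs ! j = c j"
proof -
  have "lin_comb bs c \<bullet> bs ! j = (\<Sum>i<length bs. if i = j then c i else 0)"
    unfolding lin_comb_def inner_sum_left
    using assms by (intro sum.cong) (auto simp: orthonormal_list_def)
  then show ?thesis using assms by simp
qed

lemma norm_lin_comb:
  assumes "orthonormal_list bs"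
  shows "norm (lin_comb bs c) = L2_set c {..<length bs}"
proof -
  have "lin_comb bs c \<bullet> lin_comb bs c = (\<Sum>i<length bs. c i * (lin_comb bs c \<bullet> bs ! i))"
    by (subst (2) lin_comb_def) (simp add: inner_sum_right)
  also have "\<dots> = (\<Sum>i<length bs. (c i)\<^sup>2)"
    by (intro sum.cong) (auto simp: lin_comb_inner[OF assms] power2_eq_square)
  finally show ?thesis by (simp add: norm_eq_sqrt_inner L2_set_def)
qed

lemma lin_comb_coords:
  assumes "orthonormal_list bs" "x \<in> span (set bs)"
  shows "lin_comb bs (\<lambda>i. x \<bullet> bs ! i) = x"
proof -
  define y where "y = x - lin_comb bs (\<lambda>i. x \<bullet> bs ! i)"
  have y: "y \<in> span (set bs)"
    unfolding y_def using assms lin_comb_in_span span_diff by blast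
  have "orthogonal y b" if "b \<in> set bs" for b
    using that assms by (auto simp: orthogonal_def y_def in_set_conv_nth inner_diff_left lin_comb_inner)
  then have "orthogonal y y"
    using orthogonal_to_span[OF y] by blast
  then have "y = 0" by (simp add: orthogonal_self)
  then show ?thesis by (simp add: y_def)
qed

lemma lin_comb_add: "lin_comb bs (\<lambda>i. c i + d i) = lin_comb bs c + lin_comb bs d"
  by (simp add: lin_comb_def scaleR_add_left sum.distrib)

lemma lin_comb_cong: "(\<And>i. i < length bs \<Longrightarrow> c i = d i) \<Longrightarrow> lin_comb bs c = lin_comb bs d"
  by (auto simp: lin_comb_def)

lemma orthonormal_list_distinct:
  assumes "orthonormal_list bs" shows "distinct bs"
  unfolding distinct_conv_nth
proof (intro allI impI)
  fix i j assume ij: "i < length bs" "j < length bs" "i \<noteq> j"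
  then have "bs ! i \<bullet> bs ! i = 1" "bs ! i \<bullet> bs ! j = 0"
    using assms by (auto simp: orthonormal_list_def)
  then show "bs ! i \<noteq> bs ! j" by auto
qed

lemma orthonormal_list_length:
  assumes "orthonormal_list bs" shows "length bs = dim (span (set bs))"
proof -
  have "pairwise orthogonal (set bs)"
    using assms by (auto simp: pairwise_def orthonormal_list_def orthogonal_def in_set_conv_nth)
  moreover have "0 \<notin> set bs"
    using assms by (auto simp: orthonormal_list_def in_set_conv_nth) (metis inner_zero_left zero_neq_one)
  ultimately have "independent (set bs)" by (rule pairwise_orthogonal_independent)
  then show ?thesis
    using orthonormal_list_distinct[OF assms] by (simp add: dim_eq_card_independent distinct_card)
qed

lemma measurable_lin_comb [measurable]:
  "lin_comb bs \<in> measurable (PiM {..<length bs} (\<lambda>_. lborel)) borel"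
  unfolding lin_comb_def[abs_def] by measurable

lemma space_coord_measure [simp]: "space (coord_measure bs) = UNIV"
  and sets_coord_measure [simp, measurable_cong]: "sets (coord_measure bs) = sets borel"
  by (auto simp: coord_measure_def)

text \<open>Each coordinate is an inner product with a unit vector, so the preimage of the ball lies
  in a cube. Finiteness here and positivity of the same measure later allow a ball to be
  cancelled.\<close>

lemma emeasure_coord_ball_finite:
  assumes "orthonormal_list bs"
  shows "emeasure (coord_measure bs) (ball 0 r) < \<infinity>"
proof (cases "r \<ge> 0")
  case True
  let ?M = "PiM {..<length bs} (\<lambda>_. lborel :: real measure)"
  have "emeasure (coord_measure bs) (ball 0 r) = emeasure ?M (lin_comb bs -` ball 0 r \<inter> space ?M)"
    unfolding coord_measure_def by (subst emeasure_distr) auto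
  also have "\<dots> \<le> emeasure ?M (Pi\<^sub>E {..<length bs} (\<lambda>_. {-r..r}))"
  proof (rule emeasure_mono)
    have *: "\<bar>c i\<bar> \<le> r" if "norm (lin_comb bs c) < r" "i < length bs" for c i
    proof -
      have "\<bar>c i\<bar> = \<bar>lin_comb bs c \<bullet> bs ! i\<bar>" using lin_comb_inner[OF assms] that by simp
      also have "\<dots> \<le> norm (lin_comb bs c) * norm (bs ! i)" by (rule Cauchy_Schwarz_ineq2)
      also have "norm (bs ! i) = 1" using assms that by (simp add: orthonormal_list_def norm_eq_1)
      finally show ?thesis using that by simp
    qed
    show "lin_comb bs -` ball 0 r \<inter> space ?M \<subseteq> Pi\<^sub>E {..<length bs} (\<lambda>_. {-r..r})"
    proof
      fix c assume "c \<in> lin_comb bs -` ball 0 r \<inter> space ?M"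
      then have "norm (lin_comb bs c) < r" "c \<in> extensional {..<length bs}"
        by (simp_all add: space_PiM PiE_def)
      then show "c \<in> Pi\<^sub>E {..<length bs} (\<lambda>_. {-r..r})"
        using *[of c] by (simp add: PiE_iff abs_le_iff minus_le_iff)
    qed
  qed (intro sets_PiM_I_finite, auto)
  also have "\<dots> < \<infinity>"
    using True by (simp add: lborel_family.emeasure_PiM power_less_top_ennreal)
  finally show ?thesis .
next
  case False
  then have "ball (0::'a) r = {}" by simp
  then show ?thesis by (metis emeasure_empty infinity_ennreal_def ennreal_zero_less_top)
qed

lemma emeasure_coord_ball_pos:
  assumes "orthonormal_list bs" "r > 0"
  shows "0 < emeasure (coord_measure bs) (ball 0 r)"
proof -
  let ?M = "PiM {..<length bs} (\<lambda>_. lborel :: real measure)"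
  \<comment> \<open>The \<open>+ 1\<close> makes the sum of the coordinates strictly smaller than
    \<open>r\<close> and covers the empty basis.\<close>
  define d where "d = r / (length bs + 1)"
  have d: "d > 0" using assms by (simp add: d_def)
  have "0 < emeasure ?M (Pi\<^sub>E {..<length bs} (\<lambda>_. {-d..d}))"
    using d by (simp add: lborel_family.emeasure_PiM ennreal_power)
  also have "\<dots> \<le> emeasure ?M (lin_comb bs -` ball 0 r \<inter> space ?M)"
  proof (rule emeasure_mono)
    have "norm (lin_comb bs c) < r" if c: "\<And>i. i < length bs \<Longrightarrow> \<bar>c i\<bar> \<le> d" for c
    proof -
      have "norm (lin_comb bs c) \<le> (\<Sum>i<length bs. \<bar>c i\<bar>)"
        unfolding norm_lin_comb[OF assms(1)] by (rule L2_set_le_sum_abs)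
      also have "\<dots> \<le> (\<Sum>i<length bs. d)" using c by (intro sum_mono) auto
      also have "\<dots> = length bs * d" by simp
      also have "\<dots> < r" using assms by (simp add: d_def field_simps)
      finally show ?thesis .
    qed
    then show "Pi\<^sub>E {..<length bs} (\<lambda>_. {-d..d}) \<subseteq> lin_comb bs -` ball 0 r \<inter> space ?M"
      by (fastforce simp: space_PiM PiE_def Pi_def abs_le_iff)
  qed measurable
  also have "\<dots> = emeasure (coord_measure bs) (ball 0 r)"
    unfolding coord_measure_def by (subst emeasure_distr) auto
  finally show ?thesis .
qed

lemma sigma_finite_coord_measure:
  assumes "orthonormal_list bs"
  shows "sigma_finite_measure (coord_measure bs)"
proof
  let ?A = "range (\<lambda>n::nat. ball (0::'a) (real n))"
  have "x \<in> \<Union>?A" for x :: 'a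
    using reals_Archimedean2[of "norm x"] by auto
  then show "\<exists>A. countable A \<and> A \<subseteq> sets (coord_measure bs) \<and> \<Union>A = space (coord_measure bs)
      \<and> (\<forall>a\<in>A. emeasure (coord_measure bs) a \<noteq> \<infinity>)"
    using emeasure_coord_ball_finite[OF assms] by (intro exI[of _ ?A]) (auto simp: less_top)
qed

text \<open>A product measure is determined by its boxes, and each factor is translation invariant.
  Restricting \<open>T\<close> to \<open>I\<close> keeps its values inside the space of the product
  measure.\<close>

lemma distr_PiM_lborel_translate:
  fixes e :: "nat \<Rightarrow> real"
  assumes I: "finite I"
  defines "T \<equiv> \<lambda>c. \<lambda>i\<in>I. c i + e i"
  shows "distr (PiM I (\<lambda>_. lborel)) (PiM I (\<lambda>_. lborel)) T = PiM I (\<lambda>_. lborel)"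
proof (rule lborel_family.PiM_eqI[OF I])
  have T [measurable]: "T \<in> measurable (PiM I (\<lambda>_. lborel)) (PiM I (\<lambda>_. lborel))"
    unfolding T_def by measurable
  fix A :: "nat \<Rightarrow> real set" assume A: "\<And>i. i \<in> I \<Longrightarrow> A i \<in> sets lborel"
  have meas: "(\<lambda>x. x + e i) -` A i \<in> sets lborel" if "i \<in> I" for i
    using measurable_sets[of "\<lambda>x. x + e i" borel borel "A i"] A[OF that] by simp
  have "emeasure (distr (PiM I (\<lambda>_. lborel)) (PiM I (\<lambda>_. lborel)) T) (Pi\<^sub>E I A)
      = emeasure (PiM I (\<lambda>_. lborel)) (T -` Pi\<^sub>E I A \<inter> space (PiM I (\<lambda>_. lborel)))"
    using A I by (subst emeasure_distr) (auto intro!: sets_PiM_I_finite)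
  also have "T -` Pi\<^sub>E I A \<inter> space (PiM I (\<lambda>_. lborel)) = Pi\<^sub>E I (\<lambda>i. (\<lambda>x. x + e i) -` A i)"
    by (auto simp: T_def space_PiM PiE_def Pi_def)
  also have "emeasure (PiM I (\<lambda>_. lborel)) \<dots> = (\<Prod>i\<in>I. emeasure lborel ((\<lambda>x. x + e i) -` A i))"
    using I meas by (subst lborel_family.emeasure_PiM) auto
  also have "\<dots> = (\<Prod>i\<in>I. emeasure lborel (A i))"
  proof (rule prod.cong)
    fix i assume i: "i \<in> I"
    have "emeasure lborel (A i) = emeasure (distr lborel borel ((+) (e i))) (A i)"
      by (simp add: lborel_distr_plus)
    also have "\<dots> = emeasure lborel ((\<lambda>x. x + e i) -` A i)"
      using A[OF i] by (subst emeasure_distr) (auto simp: vimage_def add.commute)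
    finally show "emeasure lborel ((\<lambda>x. x + e i) -` A i) = emeasure lborel (A i)" ..
  qed simp
  finally show "emeasure (distr (PiM I (\<lambda>_. lborel)) (PiM I (\<lambda>_. lborel)) T) (Pi\<^sub>E I A)
      = (\<Prod>i\<in>I. emeasure lborel (A i))" .
qed auto

text \<open>Adding a vector of the span amounts to adding its coordinates. This makes
  \<open>coord_measure bs\<close> a Haar measure of the span.\<close>

lemma coord_measure_translate:
  assumes "orthonormal_list bs" "e \<in> span (set bs)"
  shows "distr (coord_measure bs) borel (\<lambda>x. x + e) = coord_measure bs"
proof -
  let ?I = "{..<length bs}"
  let ?M = "PiM ?I (\<lambda>_. lborel :: real measure)"
  define T where "T = (\<lambda>c. \<lambda>i\<in>?I. c i + e \<bullet> bs ! i)"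
  have T: "T \<in> measurable ?M ?M" unfolding T_def by measurable
  have "distr (coord_measure bs) borel (\<lambda>x. x + e) = distr ?M borel (\<lambda>c. lin_comb bs c + e)"
    unfolding coord_measure_def by (subst distr_distr) (auto simp: o_def)
  also have "(\<lambda>c. lin_comb bs c + e) = lin_comb bs \<circ> T"
  proof
    fix c
    have "lin_comb bs (T c) = lin_comb bs (\<lambda>i. c i + e \<bullet> bs ! i)"
      by (rule lin_comb_cong) (simp add: T_def)
    then show "lin_comb bs c + e = (lin_comb bs \<circ> T) c"
      using assms by (simp add: lin_comb_add lin_comb_coords)
  qed
  also have "distr ?M borel (lin_comb bs \<circ> T) = distr (distr ?M ?M T) borel (lin_comb bs)"
    using T by (subst distr_distr) auto
  also have "distr ?M ?M T = ?M"
    unfolding T_def by (rule distr_PiM_lborel_translate) simp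
  finally show ?thesis by (simp add: coord_measure_def)
qed

lemma nn_integral_coord_translate:
  assumes "orthonormal_list bs" "e \<in> span (set bs)" and [measurable]: "g \<in> borel_measurable borel"
  shows "(\<integral>\<^sup>+ y. g (y + e) \<partial>coord_measure bs) = (\<integral>\<^sup>+ y. g y \<partial>coord_measure bs)"
proof -
  have "(\<integral>\<^sup>+ y. g y \<partial>coord_measure bs) = (\<integral>\<^sup>+ y. g y \<partial>distr (coord_measure bs) borel (\<lambda>x. x + e))"
    using assms by (simp add: coord_measure_translate)
  also have "\<dots> = (\<integral>\<^sup>+ y. g (y + e) \<partial>coord_measure bs)"
    by (subst nn_integral_distr) auto
  finally show ?thesis by simp
qed

lemma AE_coord_measure: "AE x in coord_measure bs. x \<in> span (set bs)"
proof -
  have [measurable]: "span (set bs) \<in> sets borel"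
    by (intro borel_closed closed_subspace) auto
  show ?thesis
    unfolding coord_measure_def by (subst AE_distr_iff) (auto simp: lin_comb_in_span)
qed

text \<open>The norm of a combination depends on its coefficients alone, so both preimages of the
  ball are the same set. This fixes the constant that uniqueness of Haar measure leaves
  open.\<close>

lemma emeasure_coord_ball_eq:
  fixes bs bs' :: "'a::euclidean_space list"
  assumes "orthonormal_list bs" "orthonormal_list bs'" "length bs = length bs'"
  shows "emeasure (coord_measure bs) (ball 0 r) = emeasure (coord_measure bs') (ball 0 r)"
proof -
  have "lin_comb bs -` ball 0 r = lin_comb bs' -` ball 0 r"
    using assms by (auto simp: norm_lin_comb)
  then show ?thesis
    using measurable_lin_comb[of bs] measurable_lin_comb[of bs'] assms(3)
    by (simp add: coord_measure_def emeasure_distr)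
qed

text \<open>This is the uniqueness of Haar measure on the span: for translation invariant \<open>\<mu>\<close> and \<open>\<nu>\<close>,
  swapping the order of integration gives \<open>\<mu>(ball) \<nu>(S) = \<mu>(S) \<nu>(ball)\<close>, and the two measures
  agree on balls.\<close>

lemma coord_measure_eq:
  assumes bs: "orthonormal_list bs" and bs': "orthonormal_list bs'"
    and span: "span (set bs) = span (set bs')"
  shows "coord_measure bs = coord_measure bs'"
proof (rule measure_eqI)
  let ?\<mu> = "coord_measure bs" and ?\<nu> = "coord_measure bs'"
  interpret pair_sigma_finite ?\<mu> ?\<nu>
    using bs bs' by (simp add: pair_sigma_finite_def sigma_finite_coord_measure)
  fix S assume "S \<in> sets ?\<mu>"
  then have S [measurable]: "S \<in> sets borel" by simp
  let ?B = "ball (0::'a) 1"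
  define f g where "f = (indicator ?B :: 'a \<Rightarrow> ennreal)" and "g = (indicator S :: 'a \<Rightarrow> ennreal)"
  have [measurable]: "f \<in> borel_measurable borel" "g \<in> borel_measurable borel"
    unfolding f_def g_def by (intro borel_measurable_indicator borel_open open_ball S)+
  have int_f: "(\<integral>\<^sup>+ x. f x \<partial>coord_measure cs) = emeasure (coord_measure cs) ?B" for cs
    unfolding f_def by (rule nn_integral_indicator) simp
  have int_g: "(\<integral>\<^sup>+ x. g x \<partial>coord_measure cs) = emeasure (coord_measure cs) S" for cs
    unfolding g_def by (rule nn_integral_indicator) simp
  \<comment> \<open>Symmetry of the ball rewrites the integrand as a translate in \<open>y\<close>,
    so that the inner integral no longer depends on \<open>x\<close>.\<close>
  have f_sym: "f (x - y) = f (y - x)" for x y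
    by (auto simp: f_def indicator_def norm_minus_commute)
  have "emeasure ?\<mu> ?B * emeasure ?\<nu> S = (\<integral>\<^sup>+ x. f x * (\<integral>\<^sup>+ y. g y \<partial>?\<nu>) \<partial>?\<mu>)"
    by (subst nn_integral_multc) (simp_all add: int_f int_g)
  also have "\<dots> = (\<integral>\<^sup>+ x. (\<integral>\<^sup>+ y. f x * g (y + x) \<partial>?\<nu>) \<partial>?\<mu>)"
  proof (intro nn_integral_cong_AE, use AE_coord_measure[of bs] in eventually_elim)
    fix x assume "x \<in> span (set bs)"
    then have "(\<integral>\<^sup>+ y. g y \<partial>?\<nu>) = (\<integral>\<^sup>+ y. g (y + x) \<partial>?\<nu>)"
      by (subst nn_integral_coord_translate[OF bs', of _ g]) (simp_all add: span)
    also have "f x * \<dots> = (\<integral>\<^sup>+ y. f x * g (y + x) \<partial>?\<nu>)"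
      by (rule nn_integral_cmult[symmetric]) measurable
    finally show "f x * (\<integral>\<^sup>+ y. g y \<partial>?\<nu>) = (\<integral>\<^sup>+ y. f x * g (y + x) \<partial>?\<nu>)" .
  qed
  also have "\<dots> = (\<integral>\<^sup>+ y. (\<integral>\<^sup>+ x. f x * g (y + x) \<partial>?\<mu>) \<partial>?\<nu>)"
    by (rule Fubini'[symmetric]) measurable
  also have "\<dots> = (\<integral>\<^sup>+ y. (\<integral>\<^sup>+ x. f (x - y) * g x \<partial>?\<mu>) \<partial>?\<nu>)"
  proof (intro nn_integral_cong_AE, use AE_coord_measure[of bs'] in eventually_elim)
    fix y assume "y \<in> span (set bs')"
    then have "(\<integral>\<^sup>+ x. f (x + y - y) * g (x + y) \<partial>?\<mu>) = (\<integral>\<^sup>+ x. f (x - y) * g x \<partial>?\<mu>)"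
      by (intro nn_integral_coord_translate[OF bs, of y "\<lambda>x. f (x - y) * g x"])
        (simp_all add: span)
    then show "(\<integral>\<^sup>+ x. f x * g (y + x) \<partial>?\<mu>) = (\<integral>\<^sup>+ x. f (x - y) * g x \<partial>?\<mu>)"
      by (simp add: add.commute)
  qed
  also have "\<dots> = (\<integral>\<^sup>+ x. (\<integral>\<^sup>+ y. f (x - y) * g x \<partial>?\<nu>) \<partial>?\<mu>)"
    by (rule Fubini') measurable
  also have "\<dots> = (\<integral>\<^sup>+ x. emeasure ?\<nu> ?B * g x \<partial>?\<mu>)"
  proof (intro nn_integral_cong_AE, use AE_coord_measure[of bs] in eventually_elim)
    fix x assume x: "x \<in> span (set bs)"
    have "(\<integral>\<^sup>+ y. f (x - y) * g x \<partial>?\<nu>) = (\<integral>\<^sup>+ y. f (y + - x) \<partial>?\<nu>) * g x"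
      by (subst nn_integral_multc[symmetric]) (simp_all add: f_sym[of x])
    also have "(\<integral>\<^sup>+ y. f (y + - x) \<partial>?\<nu>) = emeasure ?\<nu> ?B"
      using x by (subst nn_integral_coord_translate[OF bs', of _ f]) (simp_all add: span span_neg int_f)
    finally show "(\<integral>\<^sup>+ y. f (x - y) * g x \<partial>?\<nu>) = emeasure ?\<nu> ?B * g x" .
  qed
  also have "\<dots> = emeasure ?\<nu> ?B * emeasure ?\<mu> S"
    by (subst nn_integral_cmult) (simp_all add: int_g)
  also have "emeasure ?\<nu> ?B = emeasure ?\<mu> ?B"
    using bs bs' span by (intro emeasure_coord_ball_eq) (auto simp: orthonormal_list_length)
  finally show "emeasure ?\<mu> S = emeasure ?\<nu> S"
    using emeasure_coord_ball_pos[OF bs, of 1] emeasure_coord_ball_finite[OF bs, of 1]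
    by (auto simp: ennreal_mult_cancel_left)
qed simp

lemma lborel_eq_coord_measure:
  assumes "distinct bs" "set bs = (Basis :: 'a::euclidean_space set)"
  shows "coord_measure bs = lborel"
proof (rule lborel_eqI[symmetric])
  have bs: "orthonormal_list bs"
    using assms nth_mem[of _ bs]
    by (simp add: orthonormal_list_def inner_Basis nth_eq_iff_index_eq)
  fix l u :: 'a assume lu: "\<And>b. b \<in> Basis \<Longrightarrow> l \<bullet> b \<le> u \<bullet> b"
  let ?M = "PiM {..<length bs} (\<lambda>_. lborel :: real measure)"
  have inB: "i < length bs \<Longrightarrow> bs ! i \<in> Basis" for i using assms nth_mem by blast
  have "emeasure (coord_measure bs) (box l u) = emeasure ?M (lin_comb bs -` box l u \<inter> space ?M)"
    unfolding coord_measure_def by (subst emeasure_distr) auto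
  also have "lin_comb bs -` box l u \<inter> space ?M
      = Pi\<^sub>E {..<length bs} (\<lambda>i. {l \<bullet> bs ! i <..< u \<bullet> bs ! i})"
    unfolding box_def assms(2)[symmetric] all_set_conv_all_nth Ball_def[symmetric]
    by (auto simp: space_PiM PiE_def Pi_def all_set_conv_all_nth lin_comb_inner[OF bs])
  also have "emeasure ?M \<dots> = (\<Prod>i<length bs. ennreal ((u - l) \<bullet> bs ! i))"
    using lu inB by (subst lborel_family.emeasure_PiM) (auto simp: inner_diff_left intro!: prod.cong)
  also have "\<dots> = (\<Prod>b\<in>Basis. ennreal ((u - l) \<bullet> b))"
    using bij_betw_nth[OF assms(1) refl assms(2)[symmetric]] by (intro prod.reindex_bij_betw)
  also have "\<dots> = (\<Prod>b\<in>Basis. (u - l) \<bullet> b)"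
    using lu by (intro prod_ennreal) (auto simp: inner_diff_left)
  finally show "emeasure (coord_measure bs) (box l u) = (\<Prod>b\<in>Basis. (u - l) \<bullet> b)" .
qed simp

subsection \<open>Projections and volumes of segment sums\<close>

lemma compact_set_plus:
  fixes S T :: "'a::real_normed_vector set"
  assumes "compact S" "compact T" shows "compact (S + T)"
proof -
  have "S + T = {x + y | x y. x \<in> S \<and> y \<in> T}" by (auto simp: set_plus_def)
  then show ?thesis using compact_sums[OF assms] by simp
qed

text \<open>An orthonormal basis exists, so the choice in \<open>onb\<close> does deliver
  one.\<close>

lemma onb_orthonormal:
  assumes "subspace E"
  shows "orthonormal_list (onb E)" and "span (set (onb E)) = E"
proof -
  obtain B where B: "B \<subseteq> E" "pairwise orthogonal B" "\<And>x. x \<in> B \<Longrightarrow> norm x = 1"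
    "independent B" "span B = E"
    using orthonormal_basis_subspace[OF assms] by metis
  obtain bs where bs: "set bs = B" "distinct bs"
    using finite_distinct_list[OF independent_imp_finite[OF B(4)]] by blast
  have "\<exists>bs. distinct bs \<and> set bs \<subseteq> E \<and> span (set bs) = E \<and>
      (\<forall>i<length bs. \<forall>j<length bs. bs ! i \<bullet> bs ! j = (if i = j then 1 else 0))"
  proof (intro exI[of _ bs] conjI allI impI)
    fix i j assume ij: "i < length bs" "j < length bs"
    then show "bs ! i \<bullet> bs ! j = (if i = j then 1 else 0)"
      using B(2,3) bs nth_mem[OF ij(1)] nth_mem[OF ij(2)]
      by (auto simp: norm_eq_1 pairwise_def orthogonal_def nth_eq_iff_index_eq)
  qed (use B bs in auto)
  then have "distinct (onb E) \<and> set (onb E) \<subseteq> E \<and> span (set (onb E)) = E \<and>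
      (\<forall>i<length (onb E). \<forall>j<length (onb E). onb E ! i \<bullet> onb E ! j = (if i = j then 1 else 0))"
    unfolding onb_def by (rule someI_ex)
  then show "orthonormal_list (onb E)" and "span (set (onb E)) = E"
    by (simp_all add: orthonormal_list_def)
qed

text \<open>Volume may be computed in any orthonormal basis of the subspace. Two choices matter
  later: a basis of a hyperplane of \<open>E\<close> extended by its unit normal, and the standard
  basis of the whole space.\<close>

lemma kvol_eq_measure:
  assumes "orthonormal_list bs" "S \<in> sets borel"
  shows "kvol (span (set bs)) S = measure (coord_measure bs) S"
proof -
  let ?bs = "onb (span (set bs))"
  have "coord_measure bs = coord_measure ?bs"
    using onb_orthonormal[of "span (set bs)"] assms by (intro coord_measure_eq) auto
  then show ?thesis
    unfolding kvol_def Let_def coord_measure_def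
    using assms(2) measurable_lin_comb[of ?bs]
    by (simp add: measure_distr lin_comb_def vimage_def Int_def conj_commute)
qed

lemma emeasure_coord_bounded_finite:
  assumes "orthonormal_list bs" "bounded S" "S \<in> sets borel"
  shows "emeasure (coord_measure bs) S < \<infinity>"
proof -
  obtain r where "S \<subseteq> ball 0 r"
    using bounded_subset_ballD[OF assms(2)] by metis
  then have "emeasure (coord_measure bs) S \<le> emeasure (coord_measure bs) (ball 0 r)"
    by (intro emeasure_mono) auto
  also have "\<dots> < \<infinity>" by (rule emeasure_coord_ball_finite[OF assms(1)])
  finally show ?thesis .
qed

lemma emeasure_kvol:
  assumes "orthonormal_list bs" "compact S"
  shows "emeasure (coord_measure bs) S = ennreal (kvol (span (set bs)) S)"
  using emeasure_coord_bounded_finite[OF assms(1) compact_imp_bounded borel_compact] assms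
  by (simp add: kvol_eq_measure borel_compact emeasure_eq_ennreal_measure less_top[symmetric])

lemma kvol_nonneg: "0 \<le> kvol E S"
  by (simp add: kvol_def Let_def)

lemma kvol_pos:
  assumes "subspace E" "compact S" "x \<in> E" "r > 0"
    and ball: "\<And>y. y \<in> E \<Longrightarrow> dist x y < r \<Longrightarrow> y \<in> S"
  shows "0 < kvol E S"
proof -
  let ?M = "coord_measure (onb E)"
  note E = onb_orthonormal[OF assms(1)]
  have S [measurable]: "S \<in> sets borel" using assms by (simp add: borel_compact)
  have "0 < emeasure ?M (ball 0 r)"
    by (rule emeasure_coord_ball_pos[OF E(1) \<open>r > 0\<close>])
  \<comment> \<open>\<open>S\<close> contains a ball only relative to \<open>E\<close>, so the
    inclusion of the ambient ball holds up to a null set.\<close>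
  also have "\<dots> \<le> emeasure ?M ((\<lambda>y. y + x) -` S)"
  proof (rule emeasure_mono_AE)
    show "AE y in ?M. y \<in> ball 0 r \<longrightarrow> y \<in> (\<lambda>y. y + x) -` S"
      using AE_coord_measure[of "onb E"]
      by eventually_elim (use E(2) assms in \<open>auto simp: dist_norm intro!: ball subspace_add\<close>)
    show "(\<lambda>y. y + x) -` S \<in> sets ?M"
      using measurable_sets[of "\<lambda>y. y + x" borel borel S] S by simp
  qed
  also have "\<dots> = emeasure (distr ?M borel (\<lambda>y. y + x)) S"
    by (subst emeasure_distr) auto
  also have "\<dots> = emeasure ?M S"
    using E assms by (subst coord_measure_translate) auto
  also have "\<dots> = ennreal (kvol E S)"
    using emeasure_kvol[OF E(1) assms(2)] E(2) by simp
  finally show ?thesis by simp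
qed

lemma kvol_translate:
  assumes "subspace E" "compact S" "x \<in> E"
  shows "kvol E (S + {x}) = kvol E S"
proof -
  let ?M = "coord_measure (onb E)"
  note E = onb_orthonormal[OF assms(1)]
  have S: "compact (S + {x})" using assms by (intro compact_set_plus) auto
  have "emeasure ?M (S + {x}) = emeasure (distr ?M borel (\<lambda>y. y + x)) (S + {x})"
    using E assms by (subst coord_measure_translate) auto
  also have "\<dots> = emeasure ?M ((\<lambda>y. y + x) -` (S + {x}))"
    using S by (subst emeasure_distr) (auto simp: borel_compact)
  also have "(\<lambda>y. y + x) -` (S + {x}) = S"
    by (auto simp: set_plus_def)
  finally show ?thesis
    using emeasure_kvol[OF E(1) assms(2)] emeasure_kvol[OF E(1) S] E(2)
    by (simp add: kvol_nonneg)
qed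

lemma kvol_UNIV:
  fixes S :: "'a::euclidean_space set"
  assumes "compact S"
  shows "kvol UNIV S = measure lebesgue S"
proof -
  obtain bs where bs: "distinct bs" "set bs = (Basis :: 'a set)"
    using finite_distinct_list[OF finite_Basis] by blast
  have on: "orthonormal_list bs"
    using bs nth_mem[of _ bs]
    by (simp add: orthonormal_list_def inner_Basis nth_eq_iff_index_eq)
  show ?thesis
    using kvol_eq_measure[OF on] assms bs lborel_eq_coord_measure[OF bs]
    by (simp add: borel_compact)
qed

section \<open>Orthogonal projections\<close>

lemma proj_eqI:
  assumes "subspace F" "y \<in> F" "\<And>e. e \<in> F \<Longrightarrow> (x - y) \<bullet> e = 0"
  shows "proj F x = y"
  unfolding proj_def
proof (rule the_equality)
  fix z assume z: "z \<in> F \<and> (\<forall>e\<in>F. (x - z) \<bullet> e = 0)"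
  then have "z - y \<in> F" using assms by (auto intro: subspace_diff)
  then have "(x - y) \<bullet> (z - y) - (x - z) \<bullet> (z - y) = 0" using assms z by simp
  then have "(z - y) \<bullet> (z - y) = 0" by (simp add: inner_diff_left)
  then show "z = y" by simp
qed (use assms in auto)

lemma
  assumes "subspace F"
  shows proj_in: "proj F x \<in> F"
    and proj_orth: "e \<in> F \<Longrightarrow> (x - proj F x) \<bullet> e = 0"
proof -
  obtain y z where yz: "y \<in> span F" "\<And>w. w \<in> span F \<Longrightarrow> orthogonal z w" "x = y + z"
    using orthogonal_subspace_decomp_exists by metis
  then have "proj F x = y"
    using assms by (intro proj_eqI) (auto simp: orthogonal_def span_eq_iff[THEN iffD2])
  then show "proj F x \<in> F" and "e \<in> F \<Longrightarrow> (x - proj F x) \<bullet> e = 0"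
    using yz assms by (auto simp: orthogonal_def span_eq_iff[THEN iffD2])
qed

lemma linear_proj:
  assumes "subspace F" shows "linear (proj F)"
proof (rule linearI)
  fix x y show "proj F (x + y) = proj F x + proj F y"
  proof (rule proj_eqI[OF assms])
    fix e assume "e \<in> F"
    then have "(x - proj F x) \<bullet> e + (y - proj F y) \<bullet> e = 0" by (simp add: proj_orth assms)
    then show "(x + y - (proj F x + proj F y)) \<bullet> e = 0" by (simp add: algebra_simps)
  qed (simp add: assms proj_in subspace_add)
next
  fix r x show "proj F (r *\<^sub>R x) = r *\<^sub>R proj F x"
  proof (rule proj_eqI[OF assms])
    fix e assume "e \<in> F"
    then have "r * ((x - proj F x) \<bullet> e) = 0" by (simp add: proj_orth assms)
    then show "(r *\<^sub>R x - r *\<^sub>R proj F x) \<bullet> e = 0" by (simp add: algebra_simps)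
  qed (simp add: assms proj_in subspace_scale)
qed

lemma linear_image_plus: "linear f \<Longrightarrow> f ` (S + T) = f ` S + f ` T"
  by (force simp: set_plus_def linear_add)

lemma subspace_orth_hyp: "subspace (orth_hyp u)"
  by (auto simp: subspace_def orth_hyp_def inner_add_left)

lemma proj_Int_orth_hyp:
  assumes "subspace E" "u \<in> E" "norm u = 1"
  shows "proj (E \<inter> orth_hyp u) x = proj E x - (proj E x \<bullet> u) *\<^sub>R u"
proof (rule proj_eqI)
  show "subspace (E \<inter> orth_hyp u)"
    using assms by (simp add: subspace_inter subspace_orth_hyp)
  show "proj E x - (proj E x \<bullet> u) *\<^sub>R u \<in> E \<inter> orth_hyp u"
    using assms by (auto simp: orth_hyp_def inner_diff_left norm_eq_1 proj_in
        intro!: subspace_diff subspace_scale)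
  fix e assume e: "e \<in> E \<inter> orth_hyp u"
  then have "(x - proj E x) \<bullet> e = 0" "u \<bullet> e = 0"
    using assms proj_orth[OF assms(1), of e x] by (simp_all add: orth_hyp_def inner_commute[of e])
  then show "(x - (proj E x - (proj E x \<bullet> u) *\<^sub>R u)) \<bullet> e = 0"
    by (simp add: inner_diff_left)
qed

lemma proj_self: "subspace F \<Longrightarrow> x \<in> F \<Longrightarrow> proj F x = x"
  by (intro proj_eqI) auto

section \<open>Slicing along a direction and adding a segment\<close>

lemma orthonormal_list_snoc:
  assumes "orthonormal_list bs" "norm u = 1" "\<And>b. b \<in> set bs \<Longrightarrow> b \<bullet> u = 0"
  shows "orthonormal_list (bs @ [u])"
proof -
  have "u \<bullet> b = 0" if "b \<in> set bs" for b
    using assms(3)[OF that] by (simp add: inner_commute)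
  then show ?thesis
    using assms by (auto simp: orthonormal_list_def nth_append norm_eq_1 less_Suc_eq)
qed

lemma span_orthonormal_list_snoc:
  assumes "subspace E" "u \<in> E" "norm u = 1" "span (set bs) = E \<inter> orth_hyp u"
  shows "span (set (bs @ [u])) = E"
proof
  have "set bs \<subseteq> E" using assms(4) span_superset by blast
  then show "span (set (bs @ [u])) \<subseteq> E"
    using assms by (intro span_minimal) auto
  show "E \<subseteq> span (set (bs @ [u]))"
  proof
    fix x assume x: "x \<in> E"
    have "x - (x \<bullet> u) *\<^sub>R u \<in> span (set bs)"
      using assms x by (auto simp: orth_hyp_def inner_diff_left norm_eq_1
          intro!: subspace_diff subspace_scale)
    then have "x - (x \<bullet> u) *\<^sub>R u \<in> span (set (bs @ [u]))"
      using span_mono[of "set bs" "set (bs @ [u])"] by auto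
    moreover have "(x \<bullet> u) *\<^sub>R u \<in> span (set (bs @ [u]))"
      by (intro span_scale span_base) auto
    ultimately have "x - (x \<bullet> u) *\<^sub>R u + (x \<bullet> u) *\<^sub>R u \<in> span (set (bs @ [u]))"
      by (rule span_add)
    then show "x \<in> span (set (bs @ [u]))" by simp
  qed
qed

lemma lin_comb_snoc: "lin_comb (bs @ [u]) (c(length bs := y)) = lin_comb bs c + y *\<^sub>R u"
  by (simp add: lin_comb_def nth_append)

text \<open>Fubini for the splitting into the span of \<open>bs\<close> and the line through
  \<open>u\<close>; with \<open>u\<close> placed last, its coordinate is the one peeled off the
  product.\<close>

lemma nn_integral_coord_snoc:
  assumes [measurable]: "f \<in> borel_measurable borel"
  shows "(\<integral>\<^sup>+ x. f x \<partial>coord_measure (bs @ [u])) =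
    (\<integral>\<^sup>+ x. (\<integral>\<^sup>+ y. f (x + y *\<^sub>R u) \<partial>lborel) \<partial>coord_measure bs)"
proof -
  let ?M = "\<lambda>n. PiM {..<n} (\<lambda>_. lborel :: real measure)"
  have *: "{..<length (bs @ [u])} = insert (length bs) {..<length bs}" by auto
  have m: "lin_comb (bs @ [u]) \<in> measurable (PiM (insert (length bs) {..<length bs}) (\<lambda>_. lborel)) borel"
    using measurable_lin_comb[of "bs @ [u]"] unfolding * .
  have "(\<integral>\<^sup>+ x. f x \<partial>coord_measure (bs @ [u])) = 
      (\<integral>\<^sup>+ c. f (lin_comb (bs @ [u]) c) \<partial>PiM (insert (length bs) {..<length bs}) (\<lambda>_. lborel))"
    unfolding coord_measure_def * using m by (subst nn_integral_distr) auto
  also have "\<dots> = (\<integral>\<^sup>+ c. (\<integral>\<^sup>+ y. f (lin_comb (bs @ [u]) (c(length bs := y))) \<partial>lborel) \<partial>?M (length bs))"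
    using m by (subst lborel_family.product_nn_integral_insert) auto
  also have "\<dots> = (\<integral>\<^sup>+ c. (\<integral>\<^sup>+ y. f (lin_comb bs c + y *\<^sub>R u) \<partial>lborel) \<partial>?M (length bs))"
    by (simp add: lin_comb_snoc)
  also have "\<dots> = (\<integral>\<^sup>+ x. (\<integral>\<^sup>+ y. f (x + y *\<^sub>R u) \<partial>lborel) \<partial>coord_measure bs)"
    unfolding coord_measure_def by (subst nn_integral_distr) auto
  finally show ?thesis .
qed

text \<open>A nonempty compact convex set of reals is an interval, and the sum lengthens it by
  \<open>t\<close>. The empty case gives 0: lines that miss the body contribute nothing, and this is
  how its projection enters the volume formula.\<close>

lemma emeasure_interval_plus:
  fixes X :: "real set"
  assumes "compact X" "convex X" "0 \<le> t"
  shows "emeasure lborel (X + {0..t}) = emeasure lborel X + (if X = {} then 0 else ennreal t)"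
proof (cases "X = {}")
  case False
  obtain p q where X: "X = {p..q}"
    using connected_compact_interval_1[of X] assms convex_connected by auto
  then have pq: "p \<le> q" using False by auto
  have "X + {0..t} = {p..q + t}"
  proof
    show "{p..q + t} \<subseteq> X + {0..t}"
    proof
      fix z assume z: "z \<in> {p..q + t}"
      \<comment> \<open>Cutting \<open>z\<close> off at \<open>q\<close> leaves an excess of at most
        \<open>t\<close>.\<close>
      have "min z q + (z - min z q) \<in> X + {0..t}"
        using z assms pq unfolding X by (intro set_plus_intro) auto
      then show "z \<in> X + {0..t}" by simp
    qed
  qed (auto simp: X set_plus_def)
  then show ?thesis
    using assms pq by (simp add: X False flip: ennreal_plus)
qed (simp add: set_plus_def)

text \<open>Cavalieri's principle: by convexity every line parallel to \<open>u\<close> meets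
  \<open>S\<close> in an interval, and the segment lengthens each nonempty one by \<open>t\<close>.
  The lines that meet \<open>S\<close> are those through points of its projection, so integrating
  the gain yields \<open>t\<close> times the volume of the projection.\<close>

lemma kvol_add_unit_segment:
  assumes E: "subspace E" and u: "u \<in> E" "norm u = 1" and t: "0 \<le> t"
    and S: "compact S" "convex S" "S \<subseteq> E"
  shows "kvol E (S + closed_segment 0 (t *\<^sub>R u)) =
    kvol E S + t * kvol (E \<inter> orth_hyp u) (proj (E \<inter> orth_hyp u) ` S)"
proof -
  let ?F = "E \<inter> orth_hyp u" and ?S' = "S + closed_segment 0 (t *\<^sub>R u)"
  let ?bs = "onb (E \<inter> orth_hyp u)"
  have F: "subspace ?F" by (simp add: E subspace_inter subspace_orth_hyp)
  note bs = onb_orthonormal[OF F]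
  have "?bs ! i \<bullet> u = 0" if "i < length ?bs" for i
    using bs(2) span_superset[of "set ?bs"] nth_mem[OF that] by (auto simp: orth_hyp_def)
  \<comment> \<open>This basis need not be \<open>onb E\<close>; independence of the basis makes it
    admissible for \<open>kvol E\<close>.\<close>
  then have bsu: "orthonormal_list (?bs @ [u])" "span (set (?bs @ [u])) = E"
    using orthonormal_list_snoc[OF bs(1) u(2)] span_orthonormal_list_snoc[OF E u bs(2)]
    by (auto simp: in_set_conv_nth)
  have cS': "compact ?S'" using S by (intro compact_set_plus) auto
  have "linear (proj ?F)" using F by (rule linear_proj)
  then have cP: "compact (proj ?F ` S)"
    using S by (intro compact_continuous_image linear_continuous_on) (simp_all add: linear_conv_bounded_linear)
  have [measurable]: "S \<in> sets borel" "?S' \<in> sets borel" "proj ?F ` S \<in> sets borel"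
    using S cS' cP by (auto simp: borel_compact)
  define slice where "slice T x = {y. x + y *\<^sub>R u \<in> T}" for T x
  have slice_eq: "slice T x = (\<lambda>y. x + y *\<^sub>R u) -` T" for T x by (auto simp: slice_def)
  have slice_borel: "slice T x \<in> sets borel" if "T \<in> sets borel" for T x
    unfolding slice_eq using that measurable_sets[of "\<lambda>y. x + y *\<^sub>R u" borel borel T] by simp
  have vol: "emeasure (coord_measure (?bs @ [u])) T = (\<integral>\<^sup>+ x. emeasure lborel (slice T x) \<partial>coord_measure ?bs)"
    if T: "T \<in> sets borel" for T
  proof -
    have "(\<integral>\<^sup>+ y. indicator T (x + y *\<^sub>R u) \<partial>lborel) = emeasure lborel (slice T x)" for x
    proof -
      have "(\<integral>\<^sup>+ y. indicator T (x + y *\<^sub>R u) \<partial>lborel) = (\<integral>\<^sup>+ y. indicator (slice T x) y \<partial>lborel)"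
        by (intro nn_integral_cong) (auto simp: slice_def indicator_def)
      also have "\<dots> = emeasure lborel (slice T x)"
        using slice_borel[OF T] by simp
      finally show ?thesis .
    qed
    moreover have "emeasure (coord_measure (?bs @ [u])) T = (\<integral>\<^sup>+ x. indicator T x \<partial>coord_measure (?bs @ [u]))"
      using T by simp
    ultimately show ?thesis
      using T nn_integral_coord_snoc[of "indicator T" ?bs u] by simp
  qed
  have slice_plus: "slice ?S' x = slice S x + {0..t}" for x
  proof
    show "slice ?S' x \<subseteq> slice S x + {0..t}"
    proof
      fix y assume "y \<in> slice ?S' x"
      then obtain s w where sw: "s \<in> S" "0 \<le> w" "w \<le> 1" "x + y *\<^sub>R u = s + w *\<^sub>R t *\<^sub>R u"
        by (auto simp: slice_def set_plus_def in_segment)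
      have "x + (y - w * t) *\<^sub>R u = s" using sw(4) by (simp add: algebra_simps)
      then have "(y - w * t) + w * t \<in> slice S x + {0..t}"
        using sw t by (intro set_plus_intro) (auto simp: slice_def mult_left_le_one_le)
      then show "y \<in> slice S x + {0..t}" by simp
    qed
    show "slice S x + {0..t} \<subseteq> slice ?S' x"
    proof
      fix z assume "z \<in> slice S x + {0..t}"
      then obtain y w where yw: "z = y + w" "x + y *\<^sub>R u \<in> S" "0 \<le> w" "w \<le> t"
        by (auto simp: set_plus_def slice_def)
      \<comment> \<open>For \<open>t = 0\<close> the parameter \<open>w / t\<close> evaluates to 0,
        which is correct since then \<open>w = 0\<close>.\<close>
      have "w *\<^sub>R u \<in> closed_segment 0 (t *\<^sub>R u)"
        using yw t unfolding in_segment
        by (intro exI[of _ "w / t"]) (cases "t = 0", auto)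
      then have "(x + y *\<^sub>R u) + w *\<^sub>R u \<in> ?S'" using yw by (intro set_plus_intro)
      then show "z \<in> slice ?S' x" by (simp add: slice_def yw(1) algebra_simps)
    qed
  qed
  have slice_compact: "compact (slice S x)" for x
  proof -
    have "closed (slice S x)"
      unfolding slice_eq using S by (intro closed_vimage) (auto intro!: continuous_intros compact_imp_closed)
    moreover have "bounded (slice S x)"
    proof -
      obtain r where r: "\<And>s. s \<in> S \<Longrightarrow> norm s \<le> r"
        using compact_imp_bounded[OF S(1)] by (auto simp: bounded_iff)
      have "norm y \<le> r + norm x" if "y \<in> slice S x" for y
        using r[of "x + y *\<^sub>R u"] that norm_triangle_ineq4[of "x + y *\<^sub>R u" x] u by (auto simp: slice_def)
      then show ?thesis by (auto simp: bounded_iff)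
    qed
    ultimately show ?thesis by (simp add: compact_eq_bounded_closed)
  qed
  have slice_convex: "convex (slice S x)" for x
  proof (rule convexI)
    fix y z a b :: real assume *: "y \<in> slice S x" "z \<in> slice S x" "0 \<le> a" "0 \<le> b" "a + b = 1"
    then have "a *\<^sub>R (x + y *\<^sub>R u) + b *\<^sub>R (x + z *\<^sub>R u) \<in> S"
      using convexD[OF S(2)] by (simp add: slice_def)
    also have "a *\<^sub>R (x + y *\<^sub>R u) + b *\<^sub>R (x + z *\<^sub>R u) = (a + b) *\<^sub>R x + (a *\<^sub>R y + b *\<^sub>R z) *\<^sub>R u"
      by (simp add: algebra_simps)
    finally show "a *\<^sub>R y + b *\<^sub>R z \<in> slice S x" using * by (simp add: slice_def)
  qed
  \<comment> \<open>The restriction to \<open>?F\<close> matters: elsewhere a line may meet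
    \<open>S\<close> although its base point is not in the projection. The integrands below
    therefore agree only almost everywhere.\<close>
  have slice_empty: "slice S x = {} \<longleftrightarrow> x \<notin> proj ?F ` S" if x: "x \<in> ?F" for x
  proof -
    have pF: "proj ?F s = s - (s \<bullet> u) *\<^sub>R u" if "s \<in> E" for s
      using E u that by (simp add: proj_Int_orth_hyp proj_self)
    have "x \<in> proj ?F ` S" if "y \<in> slice S x" for y
    proof -
      have s: "x + y *\<^sub>R u \<in> S" using that by (simp add: slice_def)
      then have "proj ?F (x + y *\<^sub>R u) = x"
        using S(3) x u by (subst pF) (auto simp: orth_hyp_def inner_add_left norm_eq_1)
      with s show ?thesis by (metis imageI)
    qed
    moreover have "s \<bullet> u \<in> slice S x" if "s \<in> S" "x = proj ?F s" for s
      using that S(3) pF[of s] by (auto simp: slice_def)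
    ultimately show ?thesis by blast
  qed
  have "ennreal (kvol E ?S') = (\<integral>\<^sup>+ x. emeasure lborel (slice ?S' x) \<partial>coord_measure ?bs)"
    using emeasure_kvol[OF bsu(1) cS'] bsu(2) vol[of ?S'] by simp
  also have "\<dots> = (\<integral>\<^sup>+ x. emeasure lborel (slice S x) + ennreal t * indicator (proj ?F ` S) x \<partial>coord_measure ?bs)"
  proof (intro nn_integral_cong_AE, use AE_coord_measure[of ?bs] in eventually_elim)
    fix x assume "x \<in> span (set ?bs)"
    then have "x \<in> ?F" by (simp only: bs)
    then show "emeasure lborel (slice ?S' x) = emeasure lborel (slice S x) + ennreal t * indicator (proj ?F ` S) x"
      unfolding slice_plus emeasure_interval_plus[OF slice_compact slice_convex t]
      by (simp add: slice_empty indicator_def)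
  qed
  also have "\<dots> = (\<integral>\<^sup>+ x. emeasure lborel (slice S x) \<partial>coord_measure ?bs) +
      (\<integral>\<^sup>+ x. ennreal t * indicator (proj ?F ` S) x \<partial>coord_measure ?bs)"
  proof (rule nn_integral_add)
    \<comment> \<open>Measurability of the slice length comes from writing it as a parameter
      integral of a jointly measurable function.\<close>
    have "(\<lambda>x. \<integral>\<^sup>+ y. indicator S (x + y *\<^sub>R u) \<partial>lborel) \<in> borel_measurable (coord_measure ?bs)"
      by measurable
    also have "(\<lambda>x. \<integral>\<^sup>+ y. indicator S (x + y *\<^sub>R u) \<partial>lborel) = (\<lambda>x. emeasure lborel (slice S x))"
    proof
      fix x
      have "(\<integral>\<^sup>+ y. indicator S (x + y *\<^sub>R u) \<partial>lborel) = (\<integral>\<^sup>+ y. indicator (slice S x) y \<partial>lborel)"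
        by (intro nn_integral_cong) (auto simp: slice_def indicator_def)
      then show "(\<integral>\<^sup>+ y. indicator S (x + y *\<^sub>R u) \<partial>lborel) = emeasure lborel (slice S x)"
        using slice_borel[of S x] by simp
    qed
    finally show "(\<lambda>x. emeasure lborel (slice S x)) \<in> borel_measurable (coord_measure ?bs)" .
  qed measurable
  also have "\<dots> = ennreal (kvol E S) + ennreal t * ennreal (kvol ?F (proj ?F ` S))"
    using emeasure_kvol[OF bsu(1) S(1)] emeasure_kvol[OF bs(1) cP] bs(2) bsu(2) vol[of S]
    by (simp add: nn_integral_cmult)
  also have "\<dots> = ennreal (kvol E S + t * kvol ?F (proj ?F ` S))"
    using t by (simp add: kvol_nonneg ennreal_mult)
  finally show ?thesis
    using t by (simp add: kvol_nonneg del: ennreal_plus)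
qed

text \<open>The projected segment is a translate of \<open>closed_segment 0 v\<close>. For
  \<open>v = 0\<close> it collapses to a point and determines no direction, so the volume stays the
  same and the case is kept apart.\<close>

lemma kvol_proj_add_segment:
  fixes K :: "'a::euclidean_space set" and a b :: 'a
  assumes E: "subspace E" and K: "compact K" "convex K"
  defines "v \<equiv> proj E (b - a)"
  shows "kvol E (proj E ` (K + closed_segment a b)) = kvol E (proj E ` K) +
    (if v = 0 then 0 else
      norm v * kvol (E \<inter> orth_hyp (sgn v)) (proj (E \<inter> orth_hyp (sgn v)) ` K))"
proof -
  have lin: "linear (proj E)" using E by (rule linear_proj)
  have PK: "compact (proj E ` K)" "convex (proj E ` K)" "proj E ` K \<subseteq> E"
    using lin K E by (auto intro!: compact_continuous_image convex_linear_image linear_continuous_on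
        simp: linear_conv_bounded_linear proj_in)
  have "closed_segment a b = (+) a ` closed_segment 0 (b - a)"
    using closed_segment_translation[of a 0 "b - a"] by simp
  also have "\<dots> = closed_segment 0 (b - a) + {a}"
    by (auto simp: set_plus_def add.commute)
  finally have "proj E ` (K + closed_segment a b) =
      proj E ` K + (proj E ` closed_segment 0 (b - a) + {proj E a})"
    using lin by (simp add: linear_image_plus)
  also have "proj E ` closed_segment 0 (b - a) = closed_segment 0 v"
    using closed_segment_linear_image[OF lin, of 0 "b - a"] lin by (simp add: v_def linear_0)
  finally have "kvol E (proj E ` (K + closed_segment a b)) =
      kvol E ((proj E ` K + closed_segment 0 v) + {proj E a})"
    by (simp add: add.assoc)
  also have "\<dots> = kvol E (proj E ` K + closed_segment 0 v)"
    using E PK by (intro kvol_translate compact_set_plus) (auto simp: proj_in)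
  also have "\<dots> = kvol E (proj E ` K) + (if v = 0 then 0 else
      norm v * kvol (E \<inter> orth_hyp (sgn v)) (proj (E \<inter> orth_hyp (sgn v)) ` K))"
  proof (cases "v = 0")
    case True
    then show ?thesis by simp
  next
    case False
    have v: "v \<in> E" using E by (simp add: v_def proj_in)
    have u: "sgn v \<in> E" "norm (sgn v) = 1" "norm v *\<^sub>R sgn v = v"
      using False v E by (auto simp: sgn_div_norm subspace_scale)
    have "proj (E \<inter> orth_hyp (sgn v)) ` proj E ` K = proj (E \<inter> orth_hyp (sgn v)) ` K"
      unfolding image_image using E u by (simp add: proj_Int_orth_hyp proj_self proj_in)
    then show ?thesis
      using kvol_add_unit_segment[OF E u(1,2) norm_ge_zero[of v] PK] u(3) False by simp
  qed
  finally show ?thesis .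
qed

section \<open>Induction over the segments of a zonotope\<close>

lemma set_plus_eq_empty_iff: "S + T = {} \<longleftrightarrow> S = {} \<or> T = {}"
  by (auto simp: set_plus_def)

lemma zonotope_segments_compact_convex:
  fixes segs :: "('a::euclidean_space \<times> 'a) list"
  defines "Z \<equiv> foldr (\<lambda>(a, b) S. closed_segment a b + S) segs {0}"
  shows "compact Z \<and> convex Z \<and> Z \<noteq> {}"
  unfolding Z_def
  by (induction segs) (auto intro!: compact_set_plus convex_set_plus simp: set_plus_eq_empty_iff)

text \<open>The ratio condition enters as \<open>step\<close>, cleared of denominators. It speaks of
  \<open>A\<close> and \<open>C\<close> alone, whereas the new segment contributes hyperplane
  volumes of \<open>A + Z\<close> and \<open>C + Z\<close>; the induction hypothesis in the
  hyperplane bridges the two.\<close>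

lemma kvol_proj_zonotope_le:
  fixes A C :: "'a::euclidean_space set" and segs :: "('a \<times> 'a) list"
  assumes A: "compact A" "convex A" and C: "compact C" "convex C"
    and pos: "\<And>E. subspace E \<Longrightarrow> 0 < kvol E (proj E ` A)"
    and step: "\<And>E u. subspace E \<Longrightarrow> u \<in> E \<Longrightarrow> norm u = 1 \<Longrightarrow>
      kvol E (proj E ` A) * kvol (E \<inter> orth_hyp u) (proj (E \<inter> orth_hyp u) ` C)
      \<le> kvol E (proj E ` C) * kvol (E \<inter> orth_hyp u) (proj (E \<inter> orth_hyp u) ` A)"
    and E: "subspace E"
  shows "kvol E (proj E ` A) * kvol E (proj E ` (C + foldr (\<lambda>(a, b) S. closed_segment a b + S) segs {0}))
    \<le> kvol E (proj E ` C) * kvol E (proj E ` (A + foldr (\<lambda>(a, b) S. closed_segment a b + S) segs {0}))"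
  using E
proof (induction segs arbitrary: E)
  case Nil
  then show ?case by (simp flip: set_zero)
next
  case (Cons s segs)
  obtain a b where s: "s = (a, b)" by (cases s)
  define Z where "Z = foldr (\<lambda>(a, b) S. closed_segment a b + S) segs {0}"
  have Z: "compact Z" "convex Z"
    using zonotope_segments_compact_convex[of segs] by (auto simp: Z_def)
  have fold: "K + foldr (\<lambda>(a, b) S. closed_segment a b + S) (s # segs) {0}
      = (K + Z) + closed_segment a b" for K
    by (simp add: s Z_def ac_simps)
  define v where "v = proj E (b - a)"
  have seg: "kvol E (proj E ` ((K + Z) + closed_segment a b)) = kvol E (proj E ` (K + Z)) +
    (if v = 0 then 0 else
      norm v * kvol (E \<inter> orth_hyp (sgn v)) (proj (E \<inter> orth_hyp (sgn v)) ` (K + Z)))"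
    if "compact K" "convex K" for K
    unfolding v_def using that Z Cons.prems
    by (intro kvol_proj_add_segment compact_set_plus convex_set_plus) auto
  have IH: "kvol E (proj E ` A) * kvol E (proj E ` (C + Z)) \<le> kvol E (proj E ` C) * kvol E (proj E ` (A + Z))"
    using Cons.IH[OF Cons.prems] by (simp add: Z_def)
  show ?case
  proof (cases "v = 0")
    case True
    then show ?thesis unfolding fold seg[OF A] seg[OF C] using IH by simp
  next
    case False
    define F where "F = E \<inter> orth_hyp (sgn v)"
    have F: "subspace F" using Cons.prems by (simp add: F_def subspace_inter subspace_orth_hyp)
    define pA where "pA = kvol F (proj F ` A)"
    define pC where "pC = kvol F (proj F ` C)"
    define pAZ where "pAZ = kvol F (proj F ` (A + Z))"
    define pCZ where "pCZ = kvol F (proj F ` (C + Z))"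
    have IHF: "pA * pCZ \<le> pC * pAZ"
      using Cons.IH[OF F] by (simp add: Z_def pA_def pC_def pAZ_def pCZ_def)
    have "v \<in> E" using Cons.prems by (simp add: v_def proj_in)
    then have u: "sgn v \<in> E" "norm (sgn v) = 1"
      using False Cons.prems by (auto simp: sgn_div_norm subspace_scale)
    have st: "kvol E (proj E ` A) * pC \<le> kvol E (proj E ` C) * pA"
      using step[OF Cons.prems u] by (simp add: F_def pA_def pC_def)
    \<comment> \<open>Multiplying by \<open>pA\<close> lets \<open>IHF\<close> replace
      \<open>pA * pCZ\<close> by \<open>pC * pAZ\<close>, after which \<open>st\<close> trades
      \<open>pC\<close> for \<open>pA\<close>. Positivity of \<open>pA\<close> then permits
      cancellation.\<close>
    have "pA * (kvol E (proj E ` A) * pCZ) \<le> kvol E (proj E ` A) * (pC * pAZ)"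
      using mult_left_mono[OF IHF kvol_nonneg[of E "proj E ` A"]] by (simp add: mult.left_commute)
    also have "\<dots> \<le> pA * (kvol E (proj E ` C) * pAZ)"
      using mult_right_mono[OF st, of pAZ] by (simp add: pAZ_def kvol_nonneg ac_simps)
    finally have "kvol E (proj E ` A) * pCZ \<le> kvol E (proj E ` C) * pAZ"
      using pos[OF F] by (simp add: pA_def)
    then have "norm v * (kvol E (proj E ` A) * pCZ) \<le> norm v * (kvol E (proj E ` C) * pAZ)"
      by (rule mult_left_mono) simp
    then show ?thesis
      unfolding fold seg[OF A] seg[OF C] using IH False
      by (simp add: distrib_left mult.left_commute[of _ "norm v"] add_mono
          flip: F_def pAZ_def pCZ_def)
  qed
qed

lemma kvol_proj_pos:
  assumes "subspace E" "compact A" "interior A \<noteq> {}"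
  shows "0 < kvol E (proj E ` A)"
proof -
  obtain p r where pr: "r > 0" "ball p r \<subseteq> A"
    using assms(3) by (metis all_not_in_conv mem_interior)
  have lin: "linear (proj E)" using assms(1) by (rule linear_proj)
  show ?thesis
  proof (rule kvol_pos[of E _ "proj E p" r])
    fix y assume y: "y \<in> E" "dist (proj E p) y < r"
    \<comment> \<open>The correction \<open>y - proj E p\<close> lies in \<open>E\<close> and is
      shorter than \<open>r\<close>, so a preimage of \<open>y\<close> is found within the ball
      around \<open>p\<close>.\<close>
    have "proj E (p + (y - proj E p)) = y"
      using lin assms(1) y(1) by (simp add: linear_add linear_diff proj_self proj_in)
    moreover have "p + (y - proj E p) \<in> A"
      using y(2) pr(2) by (auto simp: dist_norm norm_minus_commute)
    ultimately show "y \<in> proj E ` A" by (metis imageI)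
  qed (use assms pr lin in \<open>auto intro!: compact_continuous_image linear_continuous_on
        simp: linear_conv_bounded_linear proj_in\<close>)
qed

subsection \<open>Approximation by zonotopes\<close>

text \<open>Outer regularity gives an open superset of nearly the same measure; by compactness it
  contains a uniform neighbourhood of \<open>K\<close>.\<close>

lemma measure_cball_plus_le:
  fixes K :: "'a::euclidean_space set"
  assumes "compact K" "e > 0"
  obtains d where "d > 0" "measure lebesgue (K + cball 0 d) \<le> measure lebesgue K + e"
proof -
  have K: "K \<in> lmeasurable" using assms(1) by (rule lmeasurable_compact)
  obtain U where U: "open U" "K \<subseteq> U" "U - K \<in> lmeasurable" "emeasure lebesgue (U - K) < ennreal e"
    using sets_lebesgue_outer_open[OF fmeasurableD[OF K] \<open>e > 0\<close>] by metis
  have UK: "U = K \<union> (U - K)" using U(2) by blast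
  have mU: "U \<in> lmeasurable" using fmeasurable.Un[OF K U(3)] UK by simp
  have "measure lebesgue (U - K) < e"
    using U(4) \<open>e > 0\<close> by (simp add: emeasure_eq_measure2[OF U(3)] ennreal_less_iff)
  then have less: "measure lebesgue U < measure lebesgue K + e"
    using measurable_measure_Diff[OF mU fmeasurableD[OF K] U(2)] by simp
  obtain d where d: "d > 0" "(\<Union>x\<in>K. cball x d) \<subseteq> U"
    using compact_subset_open_imp_cball_epsilon_subset[OF assms(1) U(1,2)] by blast
  have "K + cball 0 d \<subseteq> U"
  proof
    fix z assume "z \<in> K + cball 0 d"
    then obtain x y where "z = x + y" "x \<in> K" "y \<in> cball 0 d" by (auto simp: set_plus_def)
    then have "z \<in> (\<Union>x\<in>K. cball x d)" by (intro UN_I[of x]) (auto simp: dist_norm)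
    with d show "z \<in> U" by blast
  qed
  then have "measure lebesgue (K + cball 0 d) \<le> measure lebesgue U"
    using assms by (intro measure_mono_fmeasurable[OF _ _ mU] fmeasurableD lmeasurable_compact compact_set_plus) auto
  with less have "measure lebesgue (K + cball 0 d) \<le> measure lebesgue K + e" by simp
  with d(1) show ?thesis by (rule that)
qed

text \<open>A ball in \<open>C\<close> absorbs the error: \<open>C + Z\<close> lies in a translate of \<open>(1 + \<epsilon>/r)(C + W)\<close>.\<close>

lemma measure_plus_near_le:
  fixes C Z W :: "'a::euclidean_space set"
  assumes C: "compact C" "convex C" "cball p r \<subseteq> C" "r > 0"
    and W: "compact W" "convex W" "W \<noteq> {}" and Z: "compact Z"
    and near: "\<And>z. z \<in> Z \<Longrightarrow> \<exists>w\<in>W. dist z w \<le> \<epsilon>" and \<epsilon>: "\<epsilon> > 0"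
  shows "measure lebesgue (C + Z) \<le> (1 + \<epsilon> / r) ^ DIM('a) * measure lebesgue (C + W)"
proof -
  define \<delta> where "\<delta> = \<epsilon> / r"
  have \<delta>: "\<delta> > 0" using \<epsilon> C by (simp add: \<delta>_def)
  \<comment> \<open>The point \<open>w0\<close> pads \<open>w\<close>: by convexity
    \<open>w + \<delta> *\<^sub>R w0\<close> lies in the dilate of \<open>W\<close> by
    \<open>1 + \<delta>\<close>. The vector \<open>t\<close> removes the two auxiliary terms
    \<open>\<delta> *\<^sub>R p\<close> and \<open>\<delta> *\<^sub>R w0\<close>.\<close>
  obtain w0 where w0: "w0 \<in> W" using W by blast
  define t where "t = - (\<delta> *\<^sub>R p) - \<delta> *\<^sub>R w0"
  have avg: "inverse (1 + \<delta>) *\<^sub>R (x + \<delta> *\<^sub>R y) \<in> S" if "convex S" "x \<in> S" "y \<in> S" for x y :: 'a and S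
  proof -
    have "inverse (1 + \<delta>) *\<^sub>R x + (\<delta> / (1 + \<delta>)) *\<^sub>R y \<in> S"
      using that \<delta> by (intro convexD) (auto simp: field_simps)
    then show ?thesis by (simp add: algebra_simps divide_inverse)
  qed
  have "C + Z \<subseteq> (\<lambda>x. (1 + \<delta>) *\<^sub>R x + t) ` (C + W)"
  proof
    fix x assume "x \<in> C + Z"
    then obtain c z where cz: "x = c + z" "c \<in> C" "z \<in> Z" by (auto simp: set_plus_def)
    obtain w where w: "w \<in> W" "dist z w \<le> \<epsilon>" using near cz by blast
    \<comment> \<open>Chosen so that \<open>z = w + \<delta> *\<^sub>R (q - p)\<close>; since the
      error is at most \<open>\<epsilon> = \<delta> * r\<close>, the point \<open>q\<close> stays in
      the ball around \<open>p\<close>.\<close>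
    define q where "q = p + inverse \<delta> *\<^sub>R (z - w)"
    have "norm (z - w) / \<delta> \<le> r" using w(2) \<delta> C(4) \<epsilon> by (simp add: \<delta>_def dist_norm field_simps)
    then have "q \<in> C" using C(3) \<delta> by (auto simp: q_def dist_norm divide_inverse mult.commute)
    then have "inverse (1 + \<delta>) *\<^sub>R (c + \<delta> *\<^sub>R q) + inverse (1 + \<delta>) *\<^sub>R (w + \<delta> *\<^sub>R w0) \<in> C + W"
      using avg[OF C(2) cz(2)] avg[OF W(2) w(1) w0] by (intro set_plus_intro) auto
    moreover have "x = (1 + \<delta>) *\<^sub>R (inverse (1 + \<delta>) *\<^sub>R (c + \<delta> *\<^sub>R q) + inverse (1 + \<delta>) *\<^sub>R (w + \<delta> *\<^sub>R w0)) + t"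
    proof -
      have scale: "(1 + \<delta>) *\<^sub>R (inverse (1 + \<delta>) *\<^sub>R y + inverse (1 + \<delta>) *\<^sub>R y') = y + y'" for y y' :: 'a
        using \<delta> by (simp add: scaleR_add_right)
      have "\<delta> *\<^sub>R q = \<delta> *\<^sub>R p + (z - w)" using \<delta> by (simp add: q_def scaleR_add_right)
      then show ?thesis unfolding scale by (simp add: cz(1) t_def)
    qed
    ultimately show "x \<in> (\<lambda>x. (1 + \<delta>) *\<^sub>R x + t) ` (C + W)" by blast
  qed
  moreover have CW: "compact (C + W)" using C W by (intro compact_set_plus)
  then have "compact ((\<lambda>x. (1 + \<delta>) *\<^sub>R x + t) ` (C + W))"
    by (intro compact_continuous_image continuous_intros)
  ultimately have "measure lebesgue (C + Z) \<le> measure lebesgue ((\<lambda>x. (1 + \<delta>) *\<^sub>R x + t) ` (C + W))"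
    using C Z by (intro measure_mono_fmeasurable fmeasurableD lmeasurable_compact compact_set_plus) auto
  also have "\<dots> = (1 + \<delta>) ^ DIM('a) * measure lebesgue (C + W)"
    using \<delta> measure_lebesgue_affine[of "1 + \<delta>" t "C + W"] by (simp add: add.commute)
  finally show ?thesis by (simp add: \<delta>_def)
qed

text \<open>Compactness bounds the distances, so the real suprema in \<open>hausdorff_dist\<close>
  are genuine upper bounds.\<close>

lemma infdist_le_hausdorff_dist:
  fixes A B :: "'a::euclidean_space set"
  assumes "compact A" "compact B"
  shows "a \<in> A \<Longrightarrow> infdist a B \<le> hausdorff_dist A B"
    and "b \<in> B \<Longrightarrow> infdist b A \<le> hausdorff_dist A B"
proof -
  have bdd: "bdd_above ((\<lambda>x. infdist x T) ` S)" if "compact S" for S T :: "'a set"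
    using that by (intro bounded_imp_bdd_above compact_imp_bounded compact_continuous_image
        continuous_intros)
  show "infdist a B \<le> hausdorff_dist A B" if "a \<in> A"
    unfolding hausdorff_dist_def using cSUP_upper[OF that bdd[OF assms(1), of B]] by linarith
  show "infdist b A \<le> hausdorff_dist A B" if "b \<in> B"
    unfolding hausdorff_dist_def using cSUP_upper[OF that bdd[OF assms(2), of A]] by linarith
qed

lemma hausdorff_dist_near:
  fixes A B :: "'a::euclidean_space set"
  assumes "compact A" "compact B" "A \<noteq> {}" "B \<noteq> {}"
  shows "a \<in> A \<Longrightarrow> \<exists>b\<in>B. dist a b \<le> hausdorff_dist A B"
    and "b \<in> B \<Longrightarrow> \<exists>a\<in>A. dist b a \<le> hausdorff_dist A B"
  using infdist_le_hausdorff_dist[OF assms(1,2)] assms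
  by (metis infdist_attains_inf compact_imp_closed)+

theorem theorem4p14:
  fixes A B :: "'a::euclidean_space set"
  assumes "convex_body A" and "convex_body B"
    and "\<And>k E u. 1 \<le> k \<Longrightarrow> k \<le> DIM('a) \<Longrightarrow> subspace E \<Longrightarrow> dim E = k \<Longrightarrow>
           u \<in> E \<Longrightarrow> norm u = 1 \<Longrightarrow>
           kvol E (proj E ` (A + B)) / kvol (E \<inter> orth_hyp u) (proj (E \<inter> orth_hyp u) ` (A + B))
           \<ge> kvol E (proj E ` A) / kvol (E \<inter> orth_hyp u) (proj (E \<inter> orth_hyp u) ` A)"
  shows "\<And>Z. zonoid Z \<Longrightarrow>
           measure lebesgue A * measure lebesgue (A + B + Z)
           \<le> measure lebesgue (A + B) * measure lebesgue (A + Z)"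
proof -
  fix Z :: "'a set" assume "zonoid Z"
  then obtain Zs where Z: "compact Z" "Z \<noteq> {}" and Zs: "\<And>m. zonotope (Zs m)"
    and lim: "(\<lambda>m. hausdorff_dist (Zs m) Z) \<longlonglongrightarrow> 0"
    by (auto simp: zonoid_def)
  define C where "C = A + B"
  have A: "compact A" "convex A" "interior A \<noteq> {}" and B: "compact B" "convex B" "B \<noteq> {}"
    using assms(1,2) by (auto simp: convex_body_def)
  have C: "compact C" "convex C"
    using A B by (auto simp: C_def intro: compact_set_plus convex_set_plus)
  \<comment> \<open>A ball in \<open>A\<close>, shifted by a point of \<open>B\<close>, lies in
    \<open>C\<close>. It gives positive volumes of projections and the radius for the dilation
    estimate.\<close>
  obtain a b where ab: "a \<in> interior A" "b \<in> B" using A B by blast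
  obtain r where r: "r > 0" "cball a r \<subseteq> A" using ab(1) by (auto simp: mem_interior_cball)
  have ballC: "cball (a + b) r \<subseteq> C"
  proof
    fix x assume "x \<in> cball (a + b) r"
    then have "x - b \<in> cball a r" by (simp add: dist_norm algebra_simps)
    then have "(x - b) + b \<in> A + B" using r ab by (intro set_plus_intro) auto
    then show "x \<in> C" by (simp add: C_def)
  qed
  then have intC: "interior C \<noteq> {}"
    using r(1) by (metis empty_iff mem_interior_cball)
  have posA: "0 < kvol E (proj E ` A)" and posC: "0 < kvol E (proj E ` C)" if "subspace E" for E
    using that A C intC by (auto intro: kvol_proj_pos)
  \<comment> \<open>A unit vector forces \<open>dim E\<close> to be at least 1, and positive
    hyperplane volumes permit clearing denominators.\<close>
  have step: "kvol E (proj E ` A) * kvol (E \<inter> orth_hyp u) (proj (E \<inter> orth_hyp u) ` C)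
      \<le> kvol E (proj E ` C) * kvol (E \<inter> orth_hyp u) (proj (E \<inter> orth_hyp u) ` A)"
    if E: "subspace E" "u \<in> E" "norm u = 1" for E u
  proof -
    have "subspace (E \<inter> orth_hyp u)" using E by (simp add: subspace_inter subspace_orth_hyp)
    note pos = posA[OF this] posC[OF this]
    have "u \<noteq> 0" using E(3) by auto
    then have "\<not> E \<subseteq> {0}" using E(2) by auto
    then have "1 \<le> dim E" using dim_eq_0[of E] by linarith
    then show ?thesis
      using assms(3)[OF _ dim_subset_UNIV E(1) refl E(2,3), folded C_def] pos
      by (simp add: divide_le_eq le_divide_eq mult.commute)
  qed
  have zonotope_le: "measure lebesgue A * measure lebesgue (C + Zs m)
      \<le> measure lebesgue C * measure lebesgue (A + Zs m)" and Zsm: "compact (Zs m)" "convex (Zs m)" "Zs m \<noteq> {}" for m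
  proof -
    obtain segs where segs: "Zs m = foldr (\<lambda>(a, b) S. closed_segment a b + S) segs {0}"
      using Zs[of m] by (auto simp: zonotope_def)
    then show Zsm: "compact (Zs m)" "convex (Zs m)" "Zs m \<noteq> {}"
      using zonotope_segments_compact_convex[of segs] by auto
    have vol: "kvol UNIV (proj UNIV ` S) = measure lebesgue S" if "compact S" for S :: "'a set"
      using that by (simp add: proj_self kvol_UNIV)
    show "measure lebesgue A * measure lebesgue (C + Zs m)
      \<le> measure lebesgue C * measure lebesgue (A + Zs m)"
      using kvol_proj_zonotope_le[OF A(1,2) C posA step subspace_UNIV, of segs, folded segs]
      unfolding vol[OF A(1)] vol[OF C(1)] vol[OF compact_set_plus[OF A(1) Zsm(1)]]
        vol[OF compact_set_plus[OF C(1) Zsm(1)]] .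
  qed
  have approx: "measure lebesgue A * measure lebesgue (C + Z) \<le>
      (1 + \<eta>) ^ DIM('a) * (measure lebesgue C * (measure lebesgue (A + Z) + \<eta>))" if \<eta>: "\<eta> > 0" for \<eta>
  proof -
    obtain d where d: "d > 0"
      "measure lebesgue (A + Z + cball 0 d) \<le> measure lebesgue (A + Z) + \<eta>"
      using measure_cball_plus_le[OF compact_set_plus[OF A(1) Z(1)] \<eta>] by blast
    \<comment> \<open>The bound \<open>d\<close> keeps \<open>A + Zs m\<close> inside the chosen
      neighbourhood of \<open>A + Z\<close>; the bound \<open>r * \<eta>\<close> makes the dilation
      factor at most \<open>1 + \<eta>\<close>.\<close>
    define e where "e = min d (r * \<eta>)"
    have e: "e > 0" using d r \<eta> by (simp add: e_def)
    obtain m where m: "hausdorff_dist (Zs m) Z < e"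
      using order_tendstoD(2)[OF lim e] by (auto simp: eventually_sequentially)
    have "\<exists>w\<in>Zs m. dist z w \<le> e" if "z \<in> Z" for z
      using hausdorff_dist_near(2)[OF Zsm(1) Z(1) Zsm(3) Z(2) that] m by force
    then have "measure lebesgue (C + Z) \<le> (1 + e / r) ^ DIM('a) * measure lebesgue (C + Zs m)"
      using C ballC r Zsm Z e by (intro measure_plus_near_le) auto
    also have "\<dots> \<le> (1 + \<eta>) ^ DIM('a) * measure lebesgue (C + Zs m)"
      using r e by (intro mult_right_mono power_mono) (auto simp: e_def field_simps)
    finally have "measure lebesgue A * measure lebesgue (C + Z) \<le>
        (1 + \<eta>) ^ DIM('a) * (measure lebesgue A * measure lebesgue (C + Zs m))"
      using mult_left_mono[of _ _ "measure lebesgue A"] by (simp add: mult.left_commute)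
    also have "\<dots> \<le> (1 + \<eta>) ^ DIM('a) * (measure lebesgue C * measure lebesgue (A + Zs m))"
      using zonotope_le \<eta> by (intro mult_left_mono) auto
    also have "measure lebesgue (A + Zs m) \<le> measure lebesgue (A + Z + cball 0 d)"
    proof (rule measure_mono_fmeasurable)
      show "A + Zs m \<subseteq> A + Z + cball 0 d"
      proof
        fix x assume "x \<in> A + Zs m"
        then obtain y w where yw: "x = y + w" "y \<in> A" "w \<in> Zs m" by (auto simp: set_plus_def)
        obtain z where z: "z \<in> Z" "dist w z \<le> e"
          using hausdorff_dist_near(1)[OF Zsm(1) Z(1) Zsm(3) Z(2) yw(3)] m by force
        then have "(y + z) + (w - z) \<in> A + Z + cball 0 d"
          using yw by (intro set_plus_intro) (auto simp: dist_norm e_def norm_minus_commute)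
        then show "x \<in> A + Z + cball 0 d" by (simp add: yw(1))
      qed
      show "A + Zs m \<in> sets lebesgue" "A + Z + cball 0 d \<in> lmeasurable"
        using A Z Zsm by (auto intro!: fmeasurableD lmeasurable_compact compact_set_plus)
    qed
    also note d(2)
    finally show ?thesis using \<eta> by (simp add: mult_left_mono)
  qed
  \<comment> \<open>Both errors vanish as \<open>\<eta>\<close> tends to 0; the limit is one-sided
    because \<open>approx\<close> holds for positive \<open>\<eta>\<close>.\<close>
  have "((\<lambda>\<eta>. (1 + \<eta>) ^ DIM('a) * (measure lebesgue C * (measure lebesgue (A + Z) + \<eta>)))
      \<longlongrightarrow> (1 + 0) ^ DIM('a) * (measure lebesgue C * (measure lebesgue (A + Z) + 0))) (at_right 0)"
    by (intro tendsto_intros)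
  then have "measure lebesgue A * measure lebesgue (C + Z)
      \<le> (1 + 0) ^ DIM('a) * (measure lebesgue C * (measure lebesgue (A + Z) + 0))"
    by (rule tendsto_lowerbound) (auto simp: eventually_at_filter intro!: always_eventually approx)
  then show "measure lebesgue A * measure lebesgue (A + B + Z)
           \<le> measure lebesgue (A + B) * measure lebesgue (A + Z)"
    by (simp add: C_def)
qed

end
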